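(* Let $\alpha\vDash n$, $\beta\vDash m$ be compositions with $\beta\subseteq\alpha$. For any $T\in\mathrm{SIT}(\alpha/\beta)$ with $T\neq S^{row}_{\alpha/\beta}$, there is a sequence of generators $\pi_{j_i}$ and distinct tableaux $T_i\in\mathrm{SIT}(\alpha/\beta)$, $i=1,\dots,r$, such that $\pi_{j_i}(T_{i-1})=T_i$ for $i=1,2,\dots,r$, where $T_0=T$ and $T_r=S^{row}_{\alpha/\beta}$. Hence $T\preccurlyeq S^{row}_{\alpha/\beta}$ in the poset $P\mathcal{R}\mathfrak{S}^*_{\alpha/\beta}$ and $\pi_{j_r}\pi_{j_{r-1}}\cdots\pi_{j_1}(T)=S^{row}_{\alpha/\beta}$. In particular, $S^{row}_{\alpha/\beta}$ is the unique maximal element of the poset $P\mathcal{R}\mathfrak{S}^*_{\alpha/\beta}$.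
   Context: Compositions and tableaux. A composition $\alpha=(\alpha_1,\dots,\alpha_k)\vDash n$ is a finite sequence of positive integers with sum $n=|\alpha|$; $\ell(\alpha)=k$; $\emptyset$ is the empty composition of $0$. The diagram of $\alpha$ is the left-justified array of cells with $\alpha_i$ cells in row $i$, rows numbered from bottom to top. $\beta\subseteq\alpha$ means $\ell(\beta)\le\ell(\alpha)$ and $\beta_j\le\alpha_j$ for all $1\le j\le \ell(\beta)$; the skew diagram $\alpha/\beta$ is the set of cells of the diagram of $\alpha$ not in that of $\beta$, where $\beta$ is placed in the bottom-left corner of $\alpha$. $\mathrm{SIT}(\alpha/\beta)$ is the set of bijective fillings of the cells of $\alpha/\beta$ with $1,\dots,|\alpha|-|\beta|$ such that the entries in the cells of the leftmost column of $\alpha$ that are not in $\beta$ increase from bottom to top, and all rows increase from left to right. $S^{row}_{\alpha/\beta}\in\mathrm{SIT}(\alpha/\beta)$ is the row superstandard tableau: its rows are filled left to right, bottom to top, beginning with the bottom row and moving up, with $1,2,\dots,n-m$ in consecutive order. Action ($\mathcal{R}\mathfrak{S}^*$-action). For $1\le i\le n-m-1$ and $T\in\mathrm{SIT}(\alpha/\beta)$: $\pi_i(T)=T$ if $i+1$ is in a row strictly above $i$; $\pi_i(T)=s_i(T)$ (switch $i$ and $i+1$) if $i+1$ is in a row strictly below $i$; $\pi_i(T)=0$ if $i,i+1$ are in the same row. The skew immaculate Hecke poset $P\mathcal{R}\mathfrak{S}^*_{\alpha/\beta}$ is the set $\mathrm{SIT}(\alpha/\beta)$ with the partial order $\preccurlyeq$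 whose cover relations are $S\prec T$ iff $S\neq T$ and $T=\pi_i(S)$ for some $1\le i\le n-m-1$; equivalently $S\preccurlyeq T$ iff $T=\pi_{i_1}\cdots\pi_{i_r}(S)$ for some (possibly empty) sequence of generators. *)

theory Defs
  imports Main "HOL-Combinatorics.Transposition"
begin

definition is_composition :: "nat list \<Rightarrow> nat \<Rightarrow> bool" where
  "is_composition \<alpha> n \<longleftrightarrow> (\<forall>a\<in>set \<alpha>. 0 < a) \<and> sum_list \<alpha> = n"

definition comp_subseteq :: "nat list \<Rightarrow> nat list \<Rightarrow> bool" where
  "comp_subseteq \<beta> \<alpha> \<longleftrightarrow> length \<beta> \<le> length \<alpha> \<and> (\<forall>j<length \<beta>. \<beta> ! j \<le> \<alpha> ! j)"

text \<open>A cell is a pair (row, column), both counted from 1; row 1 is the bottom row.\<close>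

type_synonym cell = "nat \<times> nat"
type_synonym tableau = "cell \<Rightarrow> nat"

definition diagram :: "nat list \<Rightarrow> cell set" where
  "diagram \<alpha> = {(r, c). 1 \<le> r \<and> r \<le> length \<alpha> \<and> 1 \<le> c \<and> c \<le> \<alpha> ! (r - 1)}"

definition skew_diagram :: "nat list \<Rightarrow> nat list \<Rightarrow> cell set" where
  "skew_diagram \<alpha> \<beta> = diagram \<alpha> - diagram \<beta>"

text \<open>A filling is a function on all pairs of naturals; it is set to 0 outside the skew
  diagram, so that two tableaux are equal exactly when they agree on every cell.\<close>

definition SIT :: "nat list \<Rightarrow> nat list \<Rightarrow> tableau set" where
  "SIT \<alpha> \<beta> = {T.
     bij_betw T (skew_diagram \<alpha> \<beta>) {1..sum_list \<alpha> - sum_list \<beta>} \<and>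
     (\<forall>x. x \<notin> skew_diagram \<alpha> \<beta> \<longrightarrow> T x = 0) \<and>
     (\<forall>r r'. (r, 1) \<in> skew_diagram \<alpha> \<beta> \<and> (r', 1) \<in> skew_diagram \<alpha> \<beta> \<and> r < r' \<longrightarrow>
        T (r, 1) < T (r', 1)) \<and>
     (\<forall>r c c'. (r, c) \<in> skew_diagram \<alpha> \<beta> \<and> (r, c') \<in> skew_diagram \<alpha> \<beta> \<and> c < c' \<longrightarrow>
        T (r, c) < T (r, c'))}"

text \<open>The entry of a cell is its position when the cells are read row by row from the bottom
  row upwards, each row from left to right.\<close>

definition S_row :: "nat list \<Rightarrow> nat list \<Rightarrow> tableau" where
  "S_row \<alpha> \<beta> = (\<lambda>(r, c).
     if (r, c) \<in> skew_diagram \<alpha> \<beta>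
     then card {(r', c') \<in> skew_diagram \<alpha> \<beta>. r' < r \<or> (r' = r \<and> c' \<le> c)}
     else 0)"

definition row_of :: "nat list \<Rightarrow> nat list \<Rightarrow> tableau \<Rightarrow> nat \<Rightarrow> nat" where
  "row_of \<alpha> \<beta> T i = (THE r. \<exists>c. (r, c) \<in> skew_diagram \<alpha> \<beta> \<and> T (r, c) = i)"

text \<open>The result 0 of the action is rendered by \<^const>\<open>None\<close>. Only generator indices
  from 1 to $|\alpha| - |\beta| - 1$ are meaningful.\<close>

definition hecke_pi :: "nat list \<Rightarrow> nat list \<Rightarrow> nat \<Rightarrow> tableau \<Rightarrow> tableau option" where
  "hecke_pi \<alpha> \<beta> i T =
     (if row_of \<alpha> \<beta> T i < row_of \<alpha> \<beta> T (i + 1) then Some T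
      else if row_of \<alpha> \<beta> T (i + 1) < row_of \<alpha> \<beta> T i then Some (transpose i (i + 1) \<circ> T)
      else None)"

text \<open>For the list $[j_1, \dots, j_r]$ this is $\pi_{j_r} \cdots \pi_{j_1}(T)$: the head of
  the list acts first. Every generator sends 0 to 0.\<close>

definition hecke_word :: "nat list \<Rightarrow> nat list \<Rightarrow> nat list \<Rightarrow> tableau \<Rightarrow> tableau option" where
  "hecke_word \<alpha> \<beta> js T = fold (\<lambda>j X. Option.bind X (hecke_pi \<alpha> \<beta> j)) js (Some T)"

definition hecke_covers :: "nat list \<Rightarrow> nat list \<Rightarrow> tableau rel" where
  "hecke_covers \<alpha> \<beta> = {(S, T). S \<in> SIT \<alpha> \<beta> \<and> T \<in> SIT \<alpha> \<beta> \<and> S \<noteq> T \<and>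
     (\<exists>i\<in>{1..sum_list \<alpha> - sum_list \<beta> - 1}. hecke_pi \<alpha> \<beta> i S = Some T)}"

definition hecke_order :: "nat list \<Rightarrow> nat list \<Rightarrow> tableau rel" where
  "hecke_order \<alpha> \<beta> = {(S, T) \<in> (hecke_covers \<alpha> \<beta>)\<^sup>*. S \<in> SIT \<alpha> \<beta> \<and> T \<in> SIT \<alpha> \<beta>}"

definition maximal_elements :: "'a set \<Rightarrow> 'a rel \<Rightarrow> 'a set" where
  "maximal_elements P R = {x \<in> P. \<forall>y\<in>P. (x, y) \<in> R \<longrightarrow> y = x}"

lemma finite_skew_diagram: "finite (skew_diagram \<alpha> \<beta>)"
proof -
  have "diagram \<alpha> \<subseteq> {1..length \<alpha>} \<times> {1..sum_list \<alpha>}"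
  proof
    fix x assume "x \<in> diagram \<alpha>"
    then obtain r c where x: "x = (r, c)" "1 \<le> r" "r \<le> length \<alpha>" "1 \<le> c" "c \<le> \<alpha> ! (r - 1)"
      by (auto simp: diagram_def)
    moreover have "\<alpha> ! (r - 1) \<le> sum_list \<alpha>"
      using x by (intro member_le_sum_list nth_mem) simp_all
    ultimately show "x \<in> {1..length \<alpha>} \<times> {1..sum_list \<alpha>}"
      by simp
  qed
  then show ?thesis
    unfolding skew_diagram_def by (meson finite_Diff finite_SigmaI finite_atLeastAtMost finite_subset)
qed

lemma row_of_eq:
  assumes "T \<in> SIT \<alpha> \<beta>" "(r, c) \<in> skew_diagram \<alpha> \<beta>"
  shows "row_of \<alpha> \<beta> T (T (r, c)) = r"
proof -
  have "inj_on T (skew_diagram \<alpha> \<beta>)"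
    using assms(1) by (simp add: SIT_def bij_betw_def)
  then show ?thesis
    unfolding row_of_def using assms(2) by (intro the_equality) (auto dest: inj_onD)
qed

text \<open>The sum of the entries weighted by their row strictly increases along a cover, which
  makes the relation generated by the covers antisymmetric.\<close>

lemma hecke_covers_weight:
  assumes "(S, T) \<in> hecke_covers \<alpha> \<beta>"
  shows "(\<Sum>x\<in>skew_diagram \<alpha> \<beta>. fst x * S x) < (\<Sum>x\<in>skew_diagram \<alpha> \<beta>. fst x * T x)"
proof -
  let ?D = "skew_diagram \<alpha> \<beta>"
  from assms obtain i where S: "S \<in> SIT \<alpha> \<beta>" and ne: "S \<noteq> T"
    and i: "i \<in> {1..sum_list \<alpha> - sum_list \<beta> - 1}" and pi: "hecke_pi \<alpha> \<beta> i S = Some T"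
    unfolding hecke_covers_def by blast
  have bij: "bij_betw S ?D {1..sum_list \<alpha> - sum_list \<beta>}"
    using S by (simp add: SIT_def)
  have "i \<in> S ` ?D" "i + 1 \<in> S ` ?D"
    using bij i by (auto simp: bij_betw_def)
  then obtain p q where p: "p \<in> ?D" "S p = i" and q: "q \<in> ?D" "S q = i + 1"
    by (metis imageE)
  have rows: "row_of \<alpha> \<beta> S i = fst p" "row_of \<alpha> \<beta> S (i + 1) = fst q"
    using row_of_eq[OF S, of "fst p" "snd p"] row_of_eq[OF S, of "fst q" "snd q"] p q by auto
  have T: "T = transpose i (i + 1) \<circ> S" and lt: "fst q < fst p"
    using pi ne unfolding hecke_pi_def rows by (auto split: if_splits)
  have pq: "p \<noteq> q" using p q by auto
  let ?E = "?D - {p} - {q}"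
  have split: "(\<Sum>x\<in>?D. f x) = f p + (f q + (\<Sum>x\<in>?E. f x))" for f :: "cell \<Rightarrow> nat"
    using finite_skew_diagram[of \<alpha> \<beta>] p(1) q(1) pq
    by (metis finite_Diff insertE insert_Diff sum.remove)
  have "T x = S x" if "x \<in> ?E" for x
  proof -
    have "S x \<noteq> i" "S x \<noteq> i + 1"
      using that bij_betw_imp_inj_on[OF bij] p q by (metis DiffE insertI1 inj_onD)+
    then show ?thesis by (simp add: T transpose_def)
  qed
  then have "(\<Sum>x\<in>?E. fst x * T x) = (\<Sum>x\<in>?E. fst x * S x)"
    by simp
  moreover have "T p = i + 1" "T q = i"
    by (simp_all add: T p q)
  ultimately show ?thesis
    using lt p q by (simp add: split)
qed

lemma partial_order_on_hecke_order: "partial_order_on (SIT \<alpha> \<beta>) (hecke_order \<alpha> \<beta>)"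
proof -
  let ?w = "\<lambda>T :: tableau. \<Sum>x\<in>skew_diagram \<alpha> \<beta>. fst x * T x"
  have mono: "S = T \<or> ?w S < ?w T" if "(S, T) \<in> (hecke_covers \<alpha> \<beta>)\<^sup>*" for S T
    using that by (induction rule: rtrancl_induct) (auto dest: hecke_covers_weight)
  then have "antisym (hecke_order \<alpha> \<beta>)"
    unfolding antisym_def hecke_order_def by (blast dest: less_asym)
  moreover have "trans (hecke_order \<alpha> \<beta>)"
    unfolding trans_def hecke_order_def by (auto intro: rtrancl_trans)
  moreover have "refl_on (SIT \<alpha> \<beta>) (hecke_order \<alpha> \<beta>)" "hecke_order \<alpha> \<beta> \<subseteq> SIT \<alpha> \<beta> \<times> SIT \<alpha> \<beta>"
    unfolding refl_on_def hecke_order_def by auto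
  ultimately show ?thesis
    unfolding partial_order_on_def preorder_on_def by blast
qed

end

theory Submission
  imports Defs
begin

text \<open>Sorting: as long as some $i + 1$ lies in a row strictly below $i$, the generator $\pi_i$ swaps
  the two entries and strictly increases the sum of the entries weighted by their rows. That sum
  is bounded, so the process stops, at a tableau in which the row of $i$ is weakly increasing
  in $i$. Since rows increase from left to right, such a tableau is strictly increasing along the
  row reading order, and the row superstandard tableau is the only one with this property.\<close>

lemma card_diagram: "card (diagram \<alpha>) = sum_list \<alpha>"
proof -
  have "diagram \<alpha> = Sigma {1..length \<alpha>} (\<lambda>r. {1..\<alpha> ! (r - 1)})"
    by (auto simp: diagram_def)
  then have "card (diagram \<alpha>) = (\<Sum>r\<in>{1..length \<alpha>}. \<alpha> ! (r - 1))"
    by simp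
  also have "\<dots> = (\<Sum>r\<in>{0..<length \<alpha>}. \<alpha> ! r)"
    by (rule sum.reindex_bij_witness[of _ Suc "\<lambda>r. r - 1"]) auto
  finally show ?thesis
    by (simp add: sum_list_sum_nth)
qed

lemma diagram_mono:
  assumes "comp_subseteq \<beta> \<alpha>"
  shows "diagram \<beta> \<subseteq> diagram \<alpha>"
proof
  fix x assume "x \<in> diagram \<beta>"
  then obtain r c where x: "x = (r, c)" "1 \<le> r" "r \<le> length \<beta>" "1 \<le> c" "c \<le> \<beta> ! (r - 1)"
    by (auto simp: diagram_def)
  moreover have "r - 1 < length \<beta>"
    using x by simp
  ultimately show "x \<in> diagram \<alpha>"
    using assms by (fastforce simp: diagram_def comp_subseteq_def)
qed

text \<open>Containment of the shapes makes the truncated subtraction exact, so the number of cells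
  agrees with the size of the entry range in \<open>SIT\<close>.\<close>

lemma card_skew_diagram:
  assumes "comp_subseteq \<beta> \<alpha>"
  shows "card (skew_diagram \<alpha> \<beta>) = sum_list \<alpha> - sum_list \<beta>"
proof -
  \<comment> \<open>A straight shape is a skew shape with empty inner composition.\<close>
  have "finite (diagram \<beta>)"
  proof -
    have "diagram [] = {}"
      by (auto simp: diagram_def)
    then show ?thesis
      using finite_skew_diagram[of \<beta> "[]"] by (simp add: skew_diagram_def)
  qed
  then show ?thesis
    unfolding skew_diagram_def
    by (simp add: card_Diff_subset diagram_mono[OF assms] card_diagram)
qed

text \<open>Each entry counts an initial segment of the row reading order, and a later cell has a
  strictly larger segment, since it lies in its own segment but not in the earlier one.\<close>

lemma S_row_less:
  assumes "(r, c) \<in> skew_diagram \<alpha> \<beta>" "(r', c') \<in> skew_diagram \<alpha> \<beta>"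
    and "r < r' \<or> r = r' \<and> c < c'"
  shows "S_row \<alpha> \<beta> (r, c) < S_row \<alpha> \<beta> (r', c')"
proof -
  let ?A = "\<lambda>r c. {(r', c') \<in> skew_diagram \<alpha> \<beta>. r' < r \<or> (r' = r \<and> c' \<le> c)}"
  have "finite (?A r' c')"
    by (rule finite_subset[OF _ finite_skew_diagram]) auto
  moreover have "(r', c') \<in> ?A r' c'" "(r', c') \<notin> ?A r c" "?A r c \<subseteq> ?A r' c'"
    using assms by auto
  then have "?A r c \<subset> ?A r' c'"
    by blast
  ultimately have "card (?A r c) < card (?A r' c')"
    by (rule psubset_card_mono)
  then show ?thesis
    using assms by (simp add: S_row_def)
qed

text \<open>Strict growth along the reading order yields injectivity and also both monotonicity
  conditions. Bijectivity follows by counting: an injective map from the cells into a range of the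
  same size is onto.\<close>

lemma S_row_in_SIT:
  assumes "comp_subseteq \<beta> \<alpha>"
  shows "S_row \<alpha> \<beta> \<in> SIT \<alpha> \<beta>"
proof -
  let ?D = "skew_diagram \<alpha> \<beta>" and ?S = "S_row \<alpha> \<beta>"
  have inj: "inj_on ?S ?D"
  proof (rule inj_onI)
    fix x y assume xy: "x \<in> ?D" "y \<in> ?D" "?S x = ?S y"
    obtain r c r' c' where [simp]: "x = (r, c)" "y = (r', c')"
      by (metis surj_pair)
    show "x = y"
      using S_row_less[of r c \<alpha> \<beta> r' c'] S_row_less[of r' c' \<alpha> \<beta> r c] xy
      by (cases r r' rule: linorder_cases; cases c c' rule: linorder_cases) auto
  qed
  have "?S x \<in> {1..card ?D}" if "x \<in> ?D" for x
  proof -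
    obtain r c where [simp]: "x = (r, c)"
      by (metis surj_pair)
    let ?A = "{(r', c') \<in> ?D. r' < r \<or> (r' = r \<and> c' \<le> c)}"
    have sub: "?A \<subseteq> ?D"
      by auto
    then have "card ?A \<le> card ?D"
      by (rule card_mono[OF finite_skew_diagram])
    moreover have "(r, c) \<in> ?A" "finite ?A"
      using that finite_subset[OF sub finite_skew_diagram] by auto
    then have "card ?A > 0"
      unfolding card_gt_0_iff by blast
    ultimately show ?thesis
      using that by (simp add: S_row_def)
  qed
  then have "?S ` ?D \<subseteq> {1..card ?D}"
    by blast
  moreover have "card (?S ` ?D) = card {1..card ?D}"
    by (simp add: card_image[OF inj])
  ultimately have "?S ` ?D = {1..card ?D}"
    by (intro card_subset_eq) auto
  with inj have "bij_betw ?S ?D {1..sum_list \<alpha> - sum_list \<beta>}"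
    by (simp add: bij_betw_def card_skew_diagram[OF assms])
  moreover have "?S x = 0" if "x \<notin> ?D" for x
    using that by (cases x) (simp add: S_row_def)
  ultimately show ?thesis
    unfolding SIT_def using S_row_less[of _ _ \<alpha> \<beta>] by blast
qed

text \<open>Once \<open>T\<close> increases along the reading order, the cells read up to
  \<open>x\<close> are exactly those with entry at most \<open>T x\<close>. As \<open>T\<close> is a
  bijection onto an initial interval, there are \<open>T x\<close> of them, and this count is the
  entry of \<open>S_row\<close> at \<open>x\<close>.\<close>

lemma row_of_mono_imp_S_row:
  assumes T: "T \<in> SIT \<alpha> \<beta>"
    and asc: "\<And>i. \<lbrakk>1 \<le> i; i < sum_list \<alpha> - sum_list \<beta>\<rbrakk> \<Longrightarrow> row_of \<alpha> \<beta> T i \<le> row_of \<alpha> \<beta> T (i + 1)"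
  shows "T = S_row \<alpha> \<beta>"
proof
  let ?D = "skew_diagram \<alpha> \<beta>" and ?N = "sum_list \<alpha> - sum_list \<beta>"
  fix x :: cell
  obtain r c where x: "x = (r, c)"
    by (metis surj_pair)
  have bij: "bij_betw T ?D {1..?N}"
    and rows: "\<And>r c c'. \<lbrakk>(r, c) \<in> ?D; (r, c') \<in> ?D; c < c'\<rbrakk> \<Longrightarrow> T (r, c) < T (r, c')"
    using T by (auto simp: SIT_def)
  have range: "T y \<in> {1..?N}" if "y \<in> ?D" for y
    using bij that by (rule bij_betwE[rule_format])
  have mono: "row_of \<alpha> \<beta> T i \<le> row_of \<alpha> \<beta> T k" if "i \<le> k" "1 \<le> i" "k \<le> ?N" for i k
    using that
  proof (induction k rule: dec_induct)
    case (step k)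
    then show ?case
      using asc[of k] by simp
  qed simp
  \<comment> \<open>If the later cell had the smaller entry, \<open>mono\<close> would put it in a
    weakly lower row. The two cells would then share a row, where entries increase to the
    right.\<close>
  have le: "T (a, b) \<le> T (a', b')" if "(a, b) \<in> ?D" "(a', b') \<in> ?D" "a < a' \<or> a = a' \<and> b \<le> b'" for a b a' b'
  proof (rule ccontr)
    assume "\<not> ?thesis"
    then have lt: "T (a', b') < T (a, b)"
      by simp
    then have "a' \<le> a"
      using mono[of "T (a', b')" "T (a, b)"] range[OF that(1)] range[OF that(2)]
      by (simp add: row_of_eq[OF T that(1)] row_of_eq[OF T that(2)])
    then show False
      using that lt rows[of a b b'] by (cases "b = b'") auto
  qed
  show "T x = S_row \<alpha> \<beta> x"
  proof (cases "x \<in> ?D")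
    case True
    let ?A = "{(r', c') \<in> ?D. r' < r \<or> (r' = r \<and> c' \<le> c)}"
    have "?A = {y \<in> ?D. T y \<le> T x}"
    proof (intro equalityI subsetI)
      fix y assume "y \<in> ?A" then show "y \<in> {y \<in> ?D. T y \<le> T x}"
        using le True by (auto simp: x)
    next
      fix y assume y: "y \<in> {y \<in> ?D. T y \<le> T x}"
      obtain r' c' where y': "y = (r', c')"
        by (metis surj_pair)
      \<comment> \<open>A cell read at or after \<open>x\<close> whose entry does not exceed
        \<open>T x\<close> must be \<open>x\<close> itself, by \<open>le\<close> and
        injectivity.\<close>
      have "T y = T x" if "r < r' \<or> r = r' \<and> c \<le> c'"
        using le[of r c r' c'] that True y by (auto simp: x y')
      then have "y = x" if "r < r' \<or> r = r' \<and> c \<le> c'"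
        using that y True bij by (auto simp: bij_betw_def dest: inj_onD)
      then have "r' < r \<or> r' = r \<and> c' \<le> c"
        by (cases r r' rule: linorder_cases; cases "c \<le> c'") (auto simp: x y')
      then show "y \<in> ?A"
        using y by (simp add: y')
    qed
    moreover have "bij_betw T {y \<in> ?D. T y \<le> T x} {1..T x}"
    proof (rule bij_betw_subset[OF bij])
      have "T ` {y \<in> ?D. T y \<le> T x} = T ` ?D \<inter> {..T x}"
        by auto
      also have "\<dots> = {1..T x}"
        using bij range[OF True] by (auto simp: bij_betw_def)
      finally show "T ` {y \<in> ?D. T y \<le> T x} = {1..T x}" .
    qed auto
    then have "card {y \<in> ?D. T y \<le> T x} = T x"
      by (simp add: bij_betw_same_card)
    ultimately show ?thesis
      using True by (simp add: S_row_def x)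
  next
    case False
    with T have "T x = 0"
      by (cases x) (simp add: SIT_def)
    with False show ?thesis
      by (simp add: S_row_def x)
  qed
qed

text \<open>Switching two consecutive values reverses only the comparison between the two cells that
  hold them. Since \<open>i + 1\<close> lies strictly below \<open>i\<close>, neither the row
  condition nor the column condition requires \<open>i\<close> to precede \<open>i + 1\<close>
  there.\<close>

lemma transpose_in_SIT:
  assumes T: "T \<in> SIT \<alpha> \<beta>" and i: "1 \<le> i" "i < sum_list \<alpha> - sum_list \<beta>"
    and desc: "row_of \<alpha> \<beta> T (i + 1) < row_of \<alpha> \<beta> T i"
  shows "transpose i (i + 1) \<circ> T \<in> SIT \<alpha> \<beta>"
proof -
  let ?D = "skew_diagram \<alpha> \<beta>" and ?N = "sum_list \<alpha> - sum_list \<beta>" and ?s = "transpose i (i + 1)"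
  have bij: "bij_betw T ?D {1..?N}"
    and col: "\<And>r r'. \<lbrakk>(r, 1) \<in> ?D; (r', 1) \<in> ?D; r < r'\<rbrakk> \<Longrightarrow> T (r, 1) < T (r', 1)"
    and rows: "\<And>r c c'. \<lbrakk>(r, c) \<in> ?D; (r, c') \<in> ?D; c < c'\<rbrakk> \<Longrightarrow> T (r, c) < T (r, c')"
    using T by (auto simp: SIT_def)
  have "bij_betw ?s {1..?N} {1..?N}"
    using i by simp
  with bij have "bij_betw (?s \<circ> T) ?D {1..?N}"
    by (rule bij_betw_trans)
  \<comment> \<open>The default value 0 is fixed by the transposition because \<open>i\<close> is at
    least 1.\<close>
  moreover have "(?s \<circ> T) x = 0" if "x \<notin> ?D" for x
  proof -
    have "T x = 0"
      using that T by (cases x) (simp add: SIT_def)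
    with i show ?thesis
      by (simp add: transpose_def)
  qed
  \<comment> \<open>The case \<open>r = r'\<close> serves the row condition, the case
    \<open>r < r'\<close> the column condition.\<close>
  moreover have "(?s \<circ> T) (r, c) < (?s \<circ> T) (r', c')"
    if "(r, c) \<in> ?D" "(r', c') \<in> ?D" "r \<le> r'" "T (r, c) < T (r', c')" for r c r' c'
  proof -
    have "\<not> (T (r, c) = i \<and> T (r', c') = i + 1)"
      using desc that row_of_eq[OF T that(1)] row_of_eq[OF T that(2)] by auto
    with that(4) show ?thesis
      by (auto simp: transpose_def)
  qed
  ultimately show ?thesis
    unfolding SIT_def using col rows by (auto simp del: o_apply)
qed

text \<open>By the characterization of \<open>S_row\<close>, any other tableau has a descent of rows
  from some \<open>i\<close> to \<open>i + 1\<close>. There \<open>hecke_pi\<close> performs the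
  switch, which visibly changes the cell holding \<open>i\<close>.\<close>

lemma ex_hecke_cover:
  assumes T: "T \<in> SIT \<alpha> \<beta>" and ne: "T \<noteq> S_row \<alpha> \<beta>"
  shows "\<exists>T'. (T, T') \<in> hecke_covers \<alpha> \<beta>"
proof -
  obtain i where i: "1 \<le> i" "i < sum_list \<alpha> - sum_list \<beta>"
    and desc: "row_of \<alpha> \<beta> T (i + 1) < row_of \<alpha> \<beta> T i"
    using row_of_mono_imp_S_row[OF T] ne by (meson not_le)
  let ?T = "transpose i (i + 1) \<circ> T"
  have "i \<in> T ` skew_diagram \<alpha> \<beta>"
    using T i by (simp add: SIT_def bij_betw_def)
  then obtain x where "T x = i"
    by blast
  then have "?T x \<noteq> T x"
    by simp
  then have "T \<noteq> ?T"
    by metis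
  moreover have "hecke_pi \<alpha> \<beta> i T = Some ?T"
    using desc by (simp add: hecke_pi_def)
  ultimately have "(T, ?T) \<in> hecke_covers \<alpha> \<beta>"
    using T transpose_in_SIT[OF T i desc] i by (auto simp: hecke_covers_def)
  then show ?thesis
    by blast
qed

text \<open>Induction on the gap between the weight and \<open>?B\<close>, the weight obtained if
  every entry were replaced by the largest one.\<close>

lemma hecke_covers_rtrancl_S_row:
  assumes "T \<in> SIT \<alpha> \<beta>"
  shows "(T, S_row \<alpha> \<beta>) \<in> (hecke_covers \<alpha> \<beta>)\<^sup>*"
proof -
  let ?D = "skew_diagram \<alpha> \<beta>" and ?N = "sum_list \<alpha> - sum_list \<beta>"
  let ?w = "\<lambda>T :: tableau. \<Sum>x\<in>?D. fst x * T x"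
  let ?B = "\<Sum>x\<in>?D. fst x * ?N"
  have bound: "?w T \<le> ?B" if "T \<in> SIT \<alpha> \<beta>" for T
  proof (rule sum_mono)
    fix x assume "x \<in> ?D"
    moreover have "bij_betw T ?D {1..?N}"
      using that by (simp add: SIT_def)
    ultimately have "T x \<le> ?N"
      by (meson atLeastAtMost_iff bij_betwE)
    then show "fst x * T x \<le> fst x * ?N"
      by simp
  qed
  from assms show ?thesis
  proof (induction "?B - ?w T" arbitrary: T rule: less_induct)
    case less
    show ?case
    proof (cases "T = S_row \<alpha> \<beta>")
      case False
      then obtain T' where T': "(T, T') \<in> hecke_covers \<alpha> \<beta>"
        using ex_hecke_cover less.prems by blast
      then have "T' \<in> SIT \<alpha> \<beta>"
        by (simp add: hecke_covers_def)
      moreover have "?w T < ?w T'"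
        using hecke_covers_weight[OF T'] .
      \<comment> \<open>The subtraction is truncated, so the bound at \<open>T'\<close> is what
        turns the larger weight into a strictly smaller gap.\<close>
      ultimately have "(T', S_row \<alpha> \<beta>) \<in> (hecke_covers \<alpha> \<beta>)\<^sup>*"
        using bound[of T'] by (intro less.hyps) auto
      with T' show ?thesis
        by (rule converse_rtrancl_into_rtrancl)
    qed simp
  qed
qed

text \<open>The head of the word acts first, so lengthening the chain appends its last generator at
  the end of the list.\<close>

lemma hecke_word_chain:
  assumes "\<And>i. i < r \<Longrightarrow> hecke_pi \<alpha> \<beta> (j (Suc i)) (Ts i) = Some (Ts (Suc i))"
  shows "hecke_word \<alpha> \<beta> (map j [1..<r + 1]) (Ts 0) = Some (Ts r)"
  using assms by (induction r) (auto simp: hecke_word_def)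

text \<open>Turns a path of covers into explicit sequences of tableaux and generator indices. Its
  tableaux are distinct because the weight grows strictly at each cover.\<close>

lemma ex_hecke_chain:
  assumes "(T, S) \<in> (hecke_covers \<alpha> \<beta>)\<^sup>*"
  obtains r :: nat and j Ts where "Ts 0 = T" "Ts r = S" "inj_on Ts {0..r}"
    and "\<forall>i<r. j (Suc i) \<in> {1..sum_list \<alpha> - sum_list \<beta> - 1} \<and> Ts (Suc i) \<in> SIT \<alpha> \<beta> \<and>
           hecke_pi \<alpha> \<beta> (j (Suc i)) (Ts i) = Some (Ts (Suc i))"
proof -
  let ?w = "\<lambda>T :: tableau. \<Sum>x\<in>skew_diagram \<alpha> \<beta>. fst x * T x"
  obtain r Ts where Ts: "Ts 0 = T" "Ts r = S" "\<And>i. i < r \<Longrightarrow> (Ts i, Ts (Suc i)) \<in> hecke_covers \<alpha> \<beta>"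
    using assms by (auto simp: rtrancl_power relpow_fun_conv)
  \<comment> \<open>\<open>j k\<close> labels the step that ends in \<open>Ts k\<close>, hence the
    predecessor \<open>k - 1\<close>; it is evaluated only at successors.\<close>
  define j where "j k = (SOME i. i \<in> {1..sum_list \<alpha> - sum_list \<beta> - 1} \<and>
      hecke_pi \<alpha> \<beta> i (Ts (k - 1)) = Some (Ts k))" for k
  have j: "j (Suc i) \<in> {1..sum_list \<alpha> - sum_list \<beta> - 1} \<and>
      hecke_pi \<alpha> \<beta> (j (Suc i)) (Ts i) = Some (Ts (Suc i))" if "i < r" for i
  proof -
    have "\<exists>k. k \<in> {1..sum_list \<alpha> - sum_list \<beta> - 1} \<and> hecke_pi \<alpha> \<beta> k (Ts i) = Some (Ts (Suc i))"
      using Ts(3)[OF that] unfolding hecke_covers_def by blast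
    from someI_ex[OF this] show ?thesis
      by (simp add: j_def)
  qed
  have weight: "?w (Ts a) < ?w (Ts b)" if "a < b" "b \<le> r" for a b
    using that
  proof (induction b)
    case (Suc b)
    have "?w (Ts b) < ?w (Ts (Suc b))"
      using Suc.prems by (intro hecke_covers_weight Ts) simp
    with Suc show ?case
      by (cases "a = b") auto
  qed simp
  have "inj_on Ts {0..r}"
  proof (rule linorder_inj_onI)
    fix a b assume "a < b" "b \<in> {0..r}"
    then show "Ts a \<noteq> Ts b"
      using weight[of a b] by auto
  qed auto
  moreover have "Ts (Suc i) \<in> SIT \<alpha> \<beta>" if "i < r" for i
    using Ts(3)[OF that] by (simp add: hecke_covers_def)
  ultimately show ?thesis
    using that[of Ts r j] Ts j by blast
qed

theorem proposition6p9:
  fixes \<alpha> \<beta> :: "nat list" and n m :: nat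
  assumes "is_composition \<alpha> n" and "is_composition \<beta> m" and "comp_subseteq \<beta> \<alpha>"
  shows "(\<forall>T\<in>SIT \<alpha> \<beta>. T \<noteq> S_row \<alpha> \<beta> \<longrightarrow>
            (\<exists>(r::nat) (j :: nat \<Rightarrow> nat) (Ts :: nat \<Rightarrow> tableau).
               Ts 0 = T \<and> Ts r = S_row \<alpha> \<beta> \<and>
               inj_on Ts {0..r} \<and>
               (\<forall>i\<in>{1..r}. j i \<in> {1..n - m - 1} \<and> Ts i \<in> SIT \<alpha> \<beta> \<and>
                  hecke_pi \<alpha> \<beta> (j i) (Ts (i - 1)) = Some (Ts i)) \<and>
               hecke_word \<alpha> \<beta> (map j [1..<r + 1]) T = Some (S_row \<alpha> \<beta>)) \<and>
            (T, S_row \<alpha> \<beta>) \<in> hecke_order \<alpha> \<beta>) \<and>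
         maximal_elements (SIT \<alpha> \<beta>) (hecke_order \<alpha> \<beta>) = {S_row \<alpha> \<beta>}"
proof (intro conjI ballI impI)
  have sums: "sum_list \<alpha> = n" "sum_list \<beta> = m"
    using assms by (simp_all add: is_composition_def)
  have S: "S_row \<alpha> \<beta> \<in> SIT \<alpha> \<beta>"
    using assms(3) by (rule S_row_in_SIT)
  have below: "(T, S_row \<alpha> \<beta>) \<in> hecke_order \<alpha> \<beta>" if "T \<in> SIT \<alpha> \<beta>" for T
    using that S hecke_covers_rtrancl_S_row by (simp add: hecke_order_def)
  then show "(T, S_row \<alpha> \<beta>) \<in> hecke_order \<alpha> \<beta>" if "T \<in> SIT \<alpha> \<beta>" for T
    using that .
  have "antisym (hecke_order \<alpha> \<beta>)"
    using partial_order_on_hecke_order by (simp add: partial_order_on_def)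
  then have "y = S_row \<alpha> \<beta>" if "y \<in> SIT \<alpha> \<beta>" "(S_row \<alpha> \<beta>, y) \<in> hecke_order \<alpha> \<beta>" for y
    using below that by (metis antisymD)
  \<comment> \<open>Antisymmetry makes the greatest element maximal, and any maximal element lies
    below it and therefore equals it.\<close>
  then show "maximal_elements (SIT \<alpha> \<beta>) (hecke_order \<alpha> \<beta>) = {S_row \<alpha> \<beta>}"
    using S below unfolding maximal_elements_def by blast
  fix T assume "T \<in> SIT \<alpha> \<beta>"
  then obtain r j Ts where Ts: "Ts 0 = T" "Ts r = S_row \<alpha> \<beta>" "inj_on Ts {0..r}"
    and step: "\<forall>i<r. j (Suc i) \<in> {1..sum_list \<alpha> - sum_list \<beta> - 1} \<and> Ts (Suc i) \<in> SIT \<alpha> \<beta> \<and>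
           hecke_pi \<alpha> \<beta> (j (Suc i)) (Ts i) = Some (Ts (Suc i))"
    by (rule ex_hecke_chain[OF hecke_covers_rtrancl_S_row])
  have "j i \<in> {1..n - m - 1} \<and> Ts i \<in> SIT \<alpha> \<beta> \<and> hecke_pi \<alpha> \<beta> (j i) (Ts (i - 1)) = Some (Ts i)"
    if "i \<in> {1..r}" for i
    using step that by (cases i) (simp_all add: sums)
  moreover have "hecke_word \<alpha> \<beta> (map j [1..<r + 1]) T = Some (S_row \<alpha> \<beta>)"
    using hecke_word_chain[of r \<alpha> \<beta> j Ts] step Ts by simp
  ultimately show "\<exists>(r::nat) (j :: nat \<Rightarrow> nat) (Ts :: nat \<Rightarrow> tableau).
               Ts 0 = T \<and> Ts r = S_row \<alpha> \<beta> \<and>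
               inj_on Ts {0..r} \<and>
               (\<forall>i\<in>{1..r}. j i \<in> {1..n - m - 1} \<and> Ts i \<in> SIT \<alpha> \<beta> \<and>
                  hecke_pi \<alpha> \<beta> (j i) (Ts (i - 1)) = Some (Ts i)) \<and>
               hecke_word \<alpha> \<beta> (map j [1..<r + 1]) T = Some (S_row \<alpha> \<beta>)"
    using Ts by blast
qed

end
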